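(* The following objects $(\mathbb{K}[X],m,\bullet)$, with $\bullet$ the bilinear product given on monomials ($i,j\in\mathbb{N}$), are Zinbiel-PreLie algebras: 1. For $N\geq 1$, $\lambda,a,b\in\mathbb{K}$ with $a\neq 0$ and $b\notin\{-1,-2,-3,\ldots\}$, $\mathfrak{g}^{(1)}(N,\lambda,a,b)$: \[X^i\bullet X^j=\begin{cases} i\lambda X^i&\text{if }j=0,\\ a\dfrac{i}{\frac{j}{N}+b}X^{i+j}&\text{if }j\neq 0\text{ and }N\mid j,\\ 0&\text{otherwise.}\end{cases}\] 2. For $N\geq 1$, $\lambda,\mu\in\mathbb{K}$, $\mu\neq 0$, $\mathfrak{g}^{(2)}(N,\lambda,\mu)$: \[X^i\bullet X^j=\begin{cases} i\lambda X^i&\text{if }j=0,\\ i\mu X^{i+N}&\text{if }j=N,\\ 0&\text{otherwise.}\end{cases}\] 3. For $N\geq 1$, $\lambda,\mu\in\mathbb{K}$, $\mu\neq 0$, $\mathfrak{g}^{(3)}(N,\lambda,\mu)$: \[X^i\bullet X^j=\begin{cases} i\lambda X^i&\text{if }j=0,\\ i\mu X^{i+j}&\text{if }j\neq 0\text{ and }N\mid j,\\ 0&\text{otherwise.}\end{cases}\] 4. For $\lambda\in\mathbb{K}$, $\mathfrak{g}^{(4)}(\lambda)$: \[X^i\bullet X^j=\begin{cases} i\lambda X^i&\text{if }j=0,\\ 0&\text{otherwise.}\end{cases}\] In particular, the pre-Lie product of $\mathfrak{g}^{(4)}(0)$ is zero. Moreover, if $\bullet$ is a product on $\mathbb{K}[X]$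 such that $(\mathbb{K}[X],m,\bullet)$ is a graded Com-PreLie algebra, then $(\mathbb{K}[X],m,\bullet)$ is one of the preceding examples.
   Context: $\mathbb{K}$ is a field of characteristic zero, $m$ is the usual product of $\mathbb{K}[X]$. A Com-PreLie algebra is a vector space $A$ with bilinear products $\cdot,\bullet$ such that $\cdot$ is commutative and associative and, for all $a,b,c\in A$, $(a\bullet b)\bullet c-a\bullet(b\bullet c)=(a\bullet c)\bullet b-a\bullet(c\bullet b)$ (pre-Lie identity) and $(a\cdot b)\bullet c=(a\bullet c)\cdot b+a\cdot(b\bullet c)$ (Leibniz identity). "Graded" for $\mathbb{K}[X]$ means $X^i\bullet X^j\in\mathbb{K}X^{i+j}$ for all $i,j\in\mathbb{N}$. A Zinbiel-PreLie algebra is $(A,\prec,\bullet)$ with bilinear products such that for all $a,b,c$: $(a\prec b)\prec c=a\prec(b\prec c+c\prec b)$ (Zinbiel identity), $\bullet$ satisfies the pre-Lie identity, and $(a\prec b)\bullet c=(a\bullet c)\prec b+a\prec(b\bullet c)$ (Leibniz identity); then $a\cdot b=a\prec b+b\prec a$ is commutative and associative and $(A,\cdot,\bullet)$ is Com-PreLie. On $\mathbb{K}[X]$ the half-product is $X^i\prec X^j=\frac{i}{i+j}X^{i+j}$ for $i,j\geq 1$, extended by $X^i\prec 1=X^i$ and $1\prec X^i=0$ for $i\geq 1$ ($1\prec 1$ is not defined); the associated product is the usual one. Accordingly, "$(\mathbb{K}[X],m,\bullet)$ is a Zinbiel-PreLie algebra" means that $(\mathbb{K}[X],m,\bullet)$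 is a Com-PreLie algebra and that, with this $\prec$, the Zinbiel identity holds on $X\mathbb{K}[X]$ and the Leibniz identity $(X^i\prec X^j)\bullet X^k=(X^i\bullet X^k)\prec X^j+X^i\prec(X^j\bullet X^k)$ holds for all $i,j,k\in\mathbb{N}$ with $(i,j)\neq(0,0)$. *)

theory Defs
  imports "HOL-Computational_Algebra.Polynomial"
begin

locale com_prelie_algebra = vector_space scale
  for scale :: "'k::field \<Rightarrow> 'v::ab_group_add \<Rightarrow> 'v" +
  fixes mult :: "'v \<Rightarrow> 'v \<Rightarrow> 'v"
    and bullet :: "'v \<Rightarrow> 'v \<Rightarrow> 'v"
  assumes mult_linear_left: "Vector_Spaces.linear scale scale (\<lambda>x. mult x y)"
    and mult_linear_right: "Vector_Spaces.linear scale scale (\<lambda>y. mult x y)"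
    and bullet_linear_left: "Vector_Spaces.linear scale scale (\<lambda>x. bullet x y)"
    and bullet_linear_right: "Vector_Spaces.linear scale scale (\<lambda>y. bullet x y)"
    and mult_commute: "mult x y = mult y x"
    and mult_assoc: "mult (mult x y) z = mult x (mult y z)"
    and prelie: "bullet (bullet x y) z - bullet x (bullet y z) =
                 bullet (bullet x z) y - bullet x (bullet z y)"
    and leibniz: "bullet (mult x y) z = mult (bullet x z) y + mult x (bullet y z)"

text \<open>The bilinear product on polynomials whose value at the pair of monomials
  \<open>X^i\<close>, \<open>X^j\<close> is \<open>f i j\<close>.\<close>

definition bilin_ext ::
  "(nat \<Rightarrow> nat \<Rightarrow> 'a::comm_semiring_1 poly) \<Rightarrow> 'a poly \<Rightarrow> 'a poly \<Rightarrow> 'a poly" where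
  "bilin_ext f p q =
     (\<Sum>i\<le>degree p. \<Sum>j\<le>degree q. smult (coeff p i * coeff q j) (f i j))"

lemma bilin_ext_bound:
  assumes "degree p \<le> m" "degree q \<le> n"
  shows "bilin_ext f p q =
     (\<Sum>i\<le>m. \<Sum>j\<le>n. smult (coeff p i * coeff q j) (f i j))"
proof -
  have "bilin_ext f p q =
     (\<Sum>i\<le>degree p. \<Sum>j\<le>n. smult (coeff p i * coeff q j) (f i j))"
    unfolding bilin_ext_def
    by (intro sum.cong[OF refl] sum.mono_neutral_left)
       (use assms in \<open>auto simp: coeff_eq_0 not_le\<close>)
  also have "\<dots> = (\<Sum>i\<le>m. \<Sum>j\<le>n. smult (coeff p i * coeff q j) (f i j))"
    by (intro sum.mono_neutral_left) (use assms in \<open>auto simp: coeff_eq_0 not_le\<close>)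
  finally show ?thesis .
qed

lemma bilin_ext_monom: "bilin_ext f (monom 1 i) (monom 1 j) = f i j"
proof -
  have "bilin_ext f (monom 1 i) (monom 1 j) =
      (\<Sum>k\<le>i. \<Sum>l\<le>j. if k = i then if l = j then f i j else 0 else 0)"
    by (subst bilin_ext_bound[OF degree_monom_le degree_monom_le])
       (intro sum.cong refl, auto simp: coeff_monom)
  also have "\<dots> = (\<Sum>k\<le>i. if k = i then f i j else 0)"
    by (intro sum.cong refl) auto
  also have "\<dots> = f i j" by simp
  finally show ?thesis .
qed

lemma smult_sum_right: "smult c (\<Sum>x\<in>A. f x) = (\<Sum>x\<in>A. smult c (f x))"
  by (induction A rule: infinite_finite_induct) (simp_all add: smult_add_right)

lemma bilin_ext_linear_left:
  fixes f :: "nat \<Rightarrow> nat \<Rightarrow> 'a::field poly"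
  shows "Vector_Spaces.linear smult smult (\<lambda>p. bilin_ext f p q)"
proof unfold_locales
  fix c :: 'a and p p' :: "'a poly"
  define m where "m = max (degree p) (degree p')"
  have "degree (p + p') \<le> m" "degree p \<le> m" "degree p' \<le> m" "degree (smult c p) \<le> m"
    using degree_add_le_max[of p p'] by (auto simp: m_def)
  note B = this[THEN bilin_ext_bound, OF order_refl]
  show "bilin_ext f (p + p') q = bilin_ext f p q + bilin_ext f p' q"
    unfolding B by (simp add: algebra_simps smult_add_left sum.distrib)
  show "bilin_ext f (smult c p) q = smult c (bilin_ext f p q)"
    unfolding B by (simp add: smult_sum_right mult.assoc)
qed (simp_all add: smult_add_right smult_add_left)

lemma bilin_ext_linear_right:
  fixes f :: "nat \<Rightarrow> nat \<Rightarrow> 'a::field poly"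
  shows "Vector_Spaces.linear smult smult (\<lambda>q. bilin_ext f p q)"
proof unfold_locales
  fix c :: 'a and q q' :: "'a poly"
  define m where "m = max (degree q) (degree q')"
  have "degree (q + q') \<le> m" "degree q \<le> m" "degree q' \<le> m" "degree (smult c q) \<le> m"
    using degree_add_le_max[of q q'] by (auto simp: m_def)
  note B = this[THEN bilin_ext_bound[OF order_refl]]
  show "bilin_ext f p (q + q') = bilin_ext f p q + bilin_ext f p q'"
    unfolding B by (simp add: algebra_simps smult_add_left sum.distrib)
  show "bilin_ext f p (smult c q) = smult c (bilin_ext f p q)"
    unfolding B by (simp add: smult_sum_right mult.left_commute)
qed (simp_all add: smult_add_right smult_add_left)

text \<open>The half-product is partial: \<open>half 1 1\<close> is undefined in the mathematics. The value \<open>0\<close>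
  it gets here is a placeholder; \<open>half_defined p q\<close> says that
  the term \<open>half 1 1\<close> does not contribute to the bilinear expansion of \<open>half p q\<close>.\<close>

definition half :: "'a::field_char_0 poly \<Rightarrow> 'a poly \<Rightarrow> 'a poly" where
  "half = bilin_ext (\<lambda>i j.
     if i = 0 then 0
     else if j = 0 then monom 1 i
     else monom (of_nat i / of_nat (i + j)) (i + j))"

definition half_defined :: "'a::field_char_0 poly \<Rightarrow> 'a poly \<Rightarrow> bool" where
  "half_defined p q \<longleftrightarrow> coeff p 0 = 0 \<or> coeff q 0 = 0"

text \<open>The Zinbiel identity is required on the ideal generated by \<open>X\<close>, where all half-products
  are defined. The Leibniz identity includes the requirement that the half-products on its
  right-hand side are defined.\<close>

definition zinbiel_prelie_poly ::
  "('a::field_char_0 poly \<Rightarrow> 'a poly \<Rightarrow> 'a poly) \<Rightarrow> bool" where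
  "zinbiel_prelie_poly bullet \<longleftrightarrow>
     com_prelie_algebra smult (*) bullet \<and>
     (\<forall>p q r :: 'a poly. coeff p 0 = 0 \<and> coeff q 0 = 0 \<and> coeff r 0 = 0 \<longrightarrow>
        half (half p q) r = half p (half q r + half r q)) \<and>
     (\<forall>i j k. (i, j) \<noteq> (0, 0) \<longrightarrow>
        half_defined (bullet (monom 1 i) (monom 1 k)) (monom 1 j) \<and>
        half_defined (monom 1 i) (bullet (monom 1 j) (monom 1 k)) \<and>
        bullet (half (monom 1 i) (monom 1 j)) (monom 1 k) =
          half (bullet (monom 1 i) (monom 1 k)) (monom 1 j) +
          half (monom 1 i) (bullet (monom 1 j) (monom 1 k)))"

definition graded_product ::
  "('a::field_char_0 poly \<Rightarrow> 'a poly \<Rightarrow> 'a poly) \<Rightarrow> bool" where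
  "graded_product bullet \<longleftrightarrow>
     (\<forall>i j. \<exists>c. bullet (monom 1 i) (monom 1 j) = smult c (monom 1 (i + j)))"

definition g1 :: "nat \<Rightarrow> 'a::field_char_0 \<Rightarrow> 'a \<Rightarrow> 'a \<Rightarrow> 'a poly \<Rightarrow> 'a poly \<Rightarrow> 'a poly" where
  "g1 N l a b = bilin_ext (\<lambda>i j.
     if j = 0 then smult (of_nat i * l) (monom 1 i)
     else if N dvd j then
       smult (a * (of_nat i / (of_nat j / of_nat N + b))) (monom 1 (i + j))
     else 0)"

definition g2 :: "nat \<Rightarrow> 'a::field_char_0 \<Rightarrow> 'a \<Rightarrow> 'a poly \<Rightarrow> 'a poly \<Rightarrow> 'a poly" where
  "g2 N l \<mu> = bilin_ext (\<lambda>i j.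
     if j = 0 then smult (of_nat i * l) (monom 1 i)
     else if j = N then smult (of_nat i * \<mu>) (monom 1 (i + N))
     else 0)"

definition g3 :: "nat \<Rightarrow> 'a::field_char_0 \<Rightarrow> 'a \<Rightarrow> 'a poly \<Rightarrow> 'a poly \<Rightarrow> 'a poly" where
  "g3 N l \<mu> = bilin_ext (\<lambda>i j.
     if j = 0 then smult (of_nat i * l) (monom 1 i)
     else if N dvd j then smult (of_nat i * \<mu>) (monom 1 (i + j))
     else 0)"

definition g4 :: "'a::field_char_0 \<Rightarrow> 'a poly \<Rightarrow> 'a poly \<Rightarrow> 'a poly" where
  "g4 l = bilin_ext (\<lambda>i j.
     if j = 0 then smult (of_nat i * l) (monom 1 i)
     else 0)"

end

theory Submission
  imports Defs
begin

text \<open>By the Leibniz identity, right multiplication by \<open>q\<close> is a derivation of \<open>K[X]\<close>, hence of the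
  form \<open>p \<mapsto> p' * \<phi> q\<close> with \<open>\<phi> q = X \<bullet> q\<close>. Gradedness says that \<open>\<phi>\<close> is diagonal up to a shift,
  \<open>\<phi> X\<^sup>j = \<mu>\<^sub>j X\<^sup>j\<^sup>+\<^sup>1\<close>, so a graded product amounts to a sequence \<open>\<mu>\<close> of weights, and
  \<open>X\<^sup>i \<bullet> X\<^sup>j = i \<mu>\<^sub>j X\<^sup>i\<^sup>+\<^sup>j\<close>. The pre-Lie identity then becomes the functional equation
  \<open>(j - k) \<mu>\<^sub>j \<mu>\<^sub>k = \<mu>\<^bsub>j+k\<^esub> (j \<mu>\<^sub>k - k \<mu>\<^sub>j)\<close>, which never constrains \<open>\<mu>\<^sub>0\<close>.

  Let \<open>N \<ge> 1\<close> be the least positive index of a nonzero weight; if there is none, the product is of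
  type 4. The equation at \<open>(N, k)\<close> turns \<open>\<mu>\<^sub>k = 0\<close> into \<open>\<mu>\<^bsub>N+k\<^esub> = 0\<close>, so the support lies in the
  multiples of \<open>N\<close>. If \<open>\<mu>\<^bsub>2N\<^esub> = 0\<close>, only \<open>\<mu>\<^sub>N\<close> survives besides \<open>\<mu>\<^sub>0\<close>, which is type 2.
  Otherwise every \<open>\<mu>\<^bsub>kN\<^esub>\<close> with \<open>k \<ge> 1\<close> is nonzero, and in the reciprocals \<open>w\<^sub>k = 1 / \<mu>\<^bsub>kN\<^esub>\<close> the equation becomes linear,
  \<open>(j - k) w\<^bsub>j+k\<^esub> = j w\<^sub>j - k w\<^sub>k\<close>; its solutions are the affine sequences. A constant sequence
  gives type 3 and a nonconstant one type 1. Conversely all four families solve the equation.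

  The half-product is \<open>p \<prec> q = \<integral>\<^sub>0 p' q\<close>. Since a polynomial in characteristic zero is determined by its
  derivative and its constant term, the Zinbiel identity and the Leibniz identity for \<open>\<prec>\<close> both
  reduce to the product rule.\<close>

section \<open>Bilinear maps on polynomials\<close>

lemma linear_poly_eqI:
  fixes f g :: "'a::field poly \<Rightarrow> 'a poly"
  assumes "Vector_Spaces.linear smult smult f" "Vector_Spaces.linear smult smult g"
    and eq: "\<And>i. f (monom 1 i) = g (monom 1 i)"
  shows "f p = g p"
proof -
  interpret f: Vector_Spaces.linear smult smult f by fact
  interpret g: Vector_Spaces.linear smult smult g by fact
  have "f (\<Sum>i\<le>degree p. smult (coeff p i) (monom 1 i))
      = g (\<Sum>i\<le>degree p. smult (coeff p i) (monom 1 i))"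
    by (simp only: f.sum g.sum f.scale g.scale eq)
  then show ?thesis
    by (simp add: smult_monom poly_as_sum_of_monoms)
qed

lemma bilinear_poly_eqI:
  fixes f g :: "'a::field poly \<Rightarrow> 'a poly \<Rightarrow> 'a poly"
  assumes "\<And>q. Vector_Spaces.linear smult smult (\<lambda>p. f p q)"
    and "\<And>p. Vector_Spaces.linear smult smult (f p)"
    and "\<And>q. Vector_Spaces.linear smult smult (\<lambda>p. g p q)"
    and "\<And>p. Vector_Spaces.linear smult smult (g p)"
    and eq: "\<And>i j. f (monom 1 i) (monom 1 j) = g (monom 1 i) (monom 1 j)"
  shows "f = g"
proof (intro ext)
  fix p q
  show "f p q = g p q"
  proof (rule linear_poly_eqI[where f = "\<lambda>p. f p q" and g = "\<lambda>p. g p q"])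
    fix i
    show "f (monom 1 i) q = g (monom 1 i) q"
      by (rule linear_poly_eqI[where f = "f (monom 1 i)"]) (use assms in auto)
  qed (use assms in auto)
qed

section \<open>The half-product as an antiderivative\<close>

lemma poly_eqI_pderiv:
  fixes p q :: "'a::field_char_0 poly"
  assumes "pderiv p = pderiv q" "coeff p 0 = coeff q 0"
  shows "p = q"
proof (rule poly_eqI)
  fix n
  show "coeff p n = coeff q n"
  proof (cases n)
    case (Suc m)
    have "coeff (pderiv p) m = coeff (pderiv q) m" using assms by simp
    then show ?thesis
      using of_nat_neq_0[of m, where ?'a = 'a] by (simp add: Suc coeff_pderiv del: of_nat_Suc)
  qed (use assms in simp)
qed

lemma coeff_0_half [simp]: "coeff (half p q) 0 = 0"
  by (auto simp: half_def bilin_ext_def coeff_sum intro!: sum.neutral)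

lemma pderiv_half [simp]: "pderiv (half p q) = pderiv p * q"
proof -
  have "(\<lambda>p q. pderiv (half p q)) = (\<lambda>p q::'a poly. pderiv p * q)"
  proof (rule bilinear_poly_eqI)
    fix i j
    show "pderiv (half (monom 1 i) (monom 1 j)) = pderiv (monom 1 i) * monom (1::'a) j"
      unfolding half_def bilin_ext_monom
      by (cases i) (auto simp: pderiv_monom mult_monom simp del: of_nat_Suc of_nat_add)
  next
    fix q :: "'a poly"
    interpret l: Vector_Spaces.linear smult smult "\<lambda>p. half p q"
      unfolding half_def by (rule bilin_ext_linear_left)
    show "Vector_Spaces.linear smult smult (\<lambda>p. pderiv (half p q))"
      by unfold_locales (simp_all add: l.add l.scale pderiv_add pderiv_smult)
  next
    fix p :: "'a poly"
    interpret r: Vector_Spaces.linear smult smult "half p"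
      unfolding half_def by (rule bilin_ext_linear_right)
    show "Vector_Spaces.linear smult smult (\<lambda>q. pderiv (half p q))"
      by unfold_locales (simp_all add: r.add r.scale pderiv_add pderiv_smult)
  qed (unfold_locales, simp_all add: pderiv_add pderiv_smult smult_add_left smult_add_right algebra_simps)
  then show ?thesis by metis
qed

lemma half_add_half_commute:
  assumes "half_defined p q"
  shows "half p q + half q p = p * q"
  by (rule poly_eqI_pderiv)
     (use assms in \<open>auto simp: half_defined_def pderiv_add pderiv_mult coeff_mult_0 algebra_simps\<close>)

text \<open>Since \<open>q \<prec> r + r \<prec> q = q r\<close>, both sides are the antiderivative of \<open>p' q r\<close>.\<close>

lemma half_zinbiel:
  assumes "half_defined q r"
  shows "half (half p q) r = half p (half q r + half r q)"
  by (rule poly_eqI_pderiv) (simp_all add: half_add_half_commute[OF assms] mult.assoc)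

section \<open>Products given by a sequence of weights\<close>

text \<open>The polynomial \<open>X \<bullet> q\<close>, where \<open>X \<bullet> X\<^sup>j = \<mu>\<^sub>j X\<^sup>j\<^sup>+\<^sup>1\<close>.\<close>

definition weight_shift :: "(nat \<Rightarrow> 'a::field_char_0) \<Rightarrow> 'a poly \<Rightarrow> 'a poly" where
  "weight_shift \<mu> q = (\<Sum>j\<le>degree q. monom (coeff q j * \<mu> j) (Suc j))"

definition weighted_product :: "(nat \<Rightarrow> 'a::field_char_0) \<Rightarrow> 'a poly \<Rightarrow> 'a poly \<Rightarrow> 'a poly" where
  "weighted_product \<mu> p q = pderiv p * weight_shift \<mu> q"

definition prelie_weights :: "(nat \<Rightarrow> 'a::field_char_0) \<Rightarrow> bool" where
  "prelie_weights \<mu> \<longleftrightarrow> (\<forall>j k. (of_nat j - of_nat k) * (\<mu> j * \<mu> k) =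
     \<mu> (j + k) * (of_nat j * \<mu> k - of_nat k * \<mu> j))"

lemma coeff_weight_shift:
  "coeff (weight_shift \<mu> q) n = (case n of 0 \<Rightarrow> 0 | Suc j \<Rightarrow> coeff q j * \<mu> j)"
  by (auto simp: weight_shift_def coeff_sum coeff_eq_0 not_le split: nat.split)

lemma weight_shift_add: "weight_shift \<mu> (p + q) = weight_shift \<mu> p + weight_shift \<mu> q"
  by (rule poly_eqI) (auto simp: coeff_weight_shift algebra_simps split: nat.split)

lemma weight_shift_smult: "weight_shift \<mu> (smult c q) = smult c (weight_shift \<mu> q)"
  by (rule poly_eqI) (auto simp: coeff_weight_shift algebra_simps split: nat.split)

lemma weight_shift_monom: "weight_shift \<mu> (monom c j) = monom (c * \<mu> j) (Suc j)"
  by (rule poly_eqI) (auto simp: coeff_weight_shift split: nat.split)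

lemma weighted_product_linear_left:
  "Vector_Spaces.linear smult smult (\<lambda>p. weighted_product \<mu> p q)"
  by unfold_locales (simp_all add: weighted_product_def pderiv_add pderiv_smult algebra_simps
    smult_add_left smult_add_right)

lemma weighted_product_linear_right:
  "Vector_Spaces.linear smult smult (weighted_product \<mu> p)"
  by unfold_locales (simp_all add: weighted_product_def weight_shift_add weight_shift_smult
    algebra_simps smult_add_left smult_add_right)

lemma weighted_product_monom:
  "weighted_product \<mu> (monom 1 i) (monom 1 j) = monom (of_nat i * \<mu> j) (i + j)"
  by (cases i) (auto simp: weighted_product_def weight_shift_monom pderiv_monom mult_monom)

lemma bilin_ext_eq_weighted_product:
  assumes "\<And>i j. f i j = monom (of_nat i * \<mu> j) (i + j)"
  shows "bilin_ext f = weighted_product \<mu>"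
  by (rule bilinear_poly_eqI)
     (simp_all add: bilin_ext_linear_left bilin_ext_linear_right weighted_product_linear_left
        weighted_product_linear_right bilin_ext_monom weighted_product_monom assms)

text \<open>In the associator of \<open>p, q, r\<close> the term \<open>p'' * \<phi> q * \<phi> r\<close> is visibly symmetric in \<open>q\<close> and \<open>r\<close>.
  What remains is \<open>p'\<close> times a bilinear map of \<open>q\<close> and \<open>r\<close>; its symmetry is tested on monomials.\<close>

lemma weighted_product_com_prelie:
  fixes \<mu> :: "nat \<Rightarrow> 'a::field_char_0"
  assumes "prelie_weights \<mu>"
  shows "com_prelie_algebra smult (*) (weighted_product \<mu>)"
proof -
  define D where
    "D q r = pderiv (weight_shift \<mu> q) * weight_shift \<mu> r
           - weight_shift \<mu> (pderiv q * weight_shift \<mu> r)" for q r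
  note linear_simps = weight_shift_add weight_shift_smult pderiv_add pderiv_smult
    algebra_simps smult_add_left smult_add_right smult_diff_right
  have D_linear: "Vector_Spaces.linear smult smult (\<lambda>q. D q r)"
      "Vector_Spaces.linear smult smult (\<lambda>r. D q r)" for q r
    unfolding D_def by (unfold_locales; simp add: linear_simps)+
  have D_monom: "D (monom 1 j) (monom 1 k) =
      monom (of_nat (Suc j) * \<mu> j * \<mu> k - of_nat j * \<mu> k * \<mu> (j + k)) (Suc (j + k))" for j k
    unfolding D_def weight_shift_monom pderiv_monom mult_monom
    by (cases j) (simp_all add: diff_monom algebra_simps)
  have "D = (\<lambda>q r. D r q)"
  proof (rule bilinear_poly_eqI)
    fix j k
    have "(of_nat j - of_nat k) * (\<mu> j * \<mu> k) = \<mu> (j + k) * (of_nat j * \<mu> k - of_nat k * \<mu> j)"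
      using assms by (simp add: prelie_weights_def)
    then show "D (monom 1 j) (monom 1 k) = D (monom 1 k) (monom 1 j)"
      by (simp add: D_monom algebra_simps)
  qed (use D_linear in auto)
  then have D_commute: "D q r = D r q" for q r by metis
  show ?thesis
  proof (intro com_prelie_algebra.intro com_prelie_algebra_axioms.intro)
    show "vector_space (smult :: 'a \<Rightarrow> _)"
      by unfold_locales (simp_all add: smult_add_left smult_add_right)
    fix x y z :: "'a poly"
    have associator: "weighted_product \<mu> (weighted_product \<mu> x y) z
        - weighted_product \<mu> x (weighted_product \<mu> y z)
        = pderiv (pderiv x) * weight_shift \<mu> y * weight_shift \<mu> z + pderiv x * D y z" for y z
      by (simp add: weighted_product_def D_def pderiv_mult algebra_simps)
    show "weighted_product \<mu> (weighted_product \<mu> x y) z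
        - weighted_product \<mu> x (weighted_product \<mu> y z)
        = weighted_product \<mu> (weighted_product \<mu> x z) y
        - weighted_product \<mu> x (weighted_product \<mu> z y)"
      unfolding associator D_commute[of y z] by (simp add: mult_ac)
    show "weighted_product \<mu> (x * y) z = weighted_product \<mu> x z * y + x * weighted_product \<mu> y z"
      by (simp add: weighted_product_def pderiv_mult algebra_simps)
    show "Vector_Spaces.linear smult smult (\<lambda>x. x * y)"
      "Vector_Spaces.linear smult smult (\<lambda>y. x * y)"
      by (unfold_locales; simp add: smult_add_left smult_add_right algebra_simps)+
  qed (simp_all add: weighted_product_linear_left weighted_product_linear_right mult_ac)
qed

text \<open>Both sides have derivative \<open>(p' q \<phi> r)'\<close> and constant term zero, the latter because \<open>X\<close>
  divides all values of \<open>\<phi>\<close>.\<close>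

lemma weighted_product_half:
  "weighted_product \<mu> (half p q) r = half (weighted_product \<mu> p r) q + half p (weighted_product \<mu> q r)"
  by (rule poly_eqI_pderiv)
     (simp_all add: weighted_product_def coeff_mult_0 coeff_weight_shift pderiv_add pderiv_mult
        algebra_simps)

lemma weighted_product_zinbiel_prelie:
  assumes "prelie_weights \<mu>"
  shows "zinbiel_prelie_poly (weighted_product \<mu>)"
proof -
  have "half_defined (weighted_product \<mu> p r) q" "half_defined p (weighted_product \<mu> q r)" for p q r
    by (simp_all add: half_defined_def weighted_product_def coeff_mult_0 coeff_weight_shift)
  then show ?thesis
    unfolding zinbiel_prelie_poly_def
    using weighted_product_com_prelie[OF assms] weighted_product_half[of \<mu>]
    by (blast intro: half_zinbiel half_defined_def[THEN iffD2])
qed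

text \<open>The Leibniz identity makes the coefficient of \<open>X\<^sup>i \<bullet> X\<^sup>j\<close> additive in \<open>i\<close>, so the weights are the
  coefficients for \<open>i = 1\<close>. The pre-Lie identity for \<open>X, X\<^sup>j, X\<^sup>k\<close> is then the weight equation.\<close>

lemma graded_com_prelie_eq_weighted_product:
  fixes bullet :: "'a::field_char_0 poly \<Rightarrow> 'a poly \<Rightarrow> 'a poly"
  assumes "com_prelie_algebra smult (*) bullet" "graded_product bullet"
  obtains \<mu> where "prelie_weights \<mu>" "bullet = weighted_product \<mu>"
proof -
  interpret com_prelie_algebra smult "(*)" bullet by fact
  obtain c where c: "bullet (monom 1 i) (monom 1 j) = smult (c i j) (monom 1 (i + j))" for i j
    using assms(2) unfolding graded_product_def by metis
  have c_add: "c (i + i') j = c i j + c i' j" for i i' j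
  proof -
    have "monom (c (i + i') j) (i + i' + j) = monom (c i j + c i' j) (i + i' + j)"
      using leibniz[of "monom 1 i" "monom 1 i'" "monom 1 j"]
      by (simp add: mult_monom c smult_monom add_monom ac_simps)
    then show ?thesis by (simp only: monom_eq_iff)
  qed
  have c_eq: "c i j = of_nat i * c 1 j" for i j
  proof (induction i)
    case 0
    show ?case using c_add[of 0 0 j] by simp
  next
    case (Suc i)
    then show ?case using c_add[of i 1 j] by (simp add: algebra_simps)
  qed
  have eq: "bullet = weighted_product (c 1)"
  proof (rule bilinear_poly_eqI)
    fix i j
    show "bullet (monom 1 i) (monom 1 j) = weighted_product (c 1) (monom 1 i) (monom 1 j)"
      unfolding c weighted_product_monom c_eq[of i j] by (simp add: smult_monom)
  qed (simp_all add: bullet_linear_left bullet_linear_right weighted_product_linear_left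
        weighted_product_linear_right)
  have "prelie_weights (c 1)"
    unfolding prelie_weights_def
  proof (intro allI)
    fix j k
    have eval: "weighted_product \<mu> (monom a i) (monom b j) = monom (a * b * of_nat i * \<mu> j) (i + j)"
      for \<mu> :: "nat \<Rightarrow> 'a" and a b i j
      by (cases i) (simp_all add: weighted_product_def pderiv_monom weight_shift_monom mult_monom)
    let ?\<mu> = "c 1"
    have "monom (of_nat (Suc j) * ?\<mu> j * ?\<mu> k - of_nat j * ?\<mu> k * ?\<mu> (j + k)) (Suc (j + k))
        = monom (of_nat (Suc k) * ?\<mu> k * ?\<mu> j - of_nat k * ?\<mu> j * ?\<mu> (j + k)) (Suc (j + k))"
      using prelie[of "monom 1 1" "monom 1 j" "monom 1 k"]
      by (simp add: eq eval diff_monom ac_simps)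
    then have "of_nat (Suc j) * ?\<mu> j * ?\<mu> k - of_nat j * ?\<mu> k * ?\<mu> (j + k)
        = of_nat (Suc k) * ?\<mu> k * ?\<mu> j - of_nat k * ?\<mu> j * ?\<mu> (j + k)"
      by (simp only: monom_eq_iff)
    then show "(of_nat j - of_nat k) * (?\<mu> j * ?\<mu> k)
        = ?\<mu> (j + k) * (of_nat j * ?\<mu> k - of_nat k * ?\<mu> j)"
      by (simp add: algebra_simps)
  qed
  with eq show ?thesis using that by blast
qed

section \<open>The four families of weights\<close>

definition weight1 :: "nat \<Rightarrow> 'a::field_char_0 \<Rightarrow> 'a \<Rightarrow> 'a \<Rightarrow> nat \<Rightarrow> 'a" where
  "weight1 N l a b j =
     (if j = 0 then l else if N dvd j then a / (of_nat j / of_nat N + b) else 0)"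

definition weight2 :: "nat \<Rightarrow> 'a::field_char_0 \<Rightarrow> 'a \<Rightarrow> nat \<Rightarrow> 'a" where
  "weight2 N l \<mu> j = (if j = 0 then l else if j = N then \<mu> else 0)"

definition weight3 :: "nat \<Rightarrow> 'a::field_char_0 \<Rightarrow> 'a \<Rightarrow> nat \<Rightarrow> 'a" where
  "weight3 N l \<mu> j = (if j = 0 then l else if N dvd j then \<mu> else 0)"

definition weight4 :: "'a::field_char_0 \<Rightarrow> nat \<Rightarrow> 'a" where
  "weight4 l j = (if j = 0 then l else 0)"

lemma g1_eq: "g1 N l a b = weighted_product (weight1 N l a b)"
  unfolding g1_def
  by (rule bilin_ext_eq_weighted_product) (auto simp: weight1_def smult_monom)

lemma g2_eq: "g2 N l \<mu> = weighted_product (weight2 N l \<mu>)"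
  unfolding g2_def
  by (rule bilin_ext_eq_weighted_product) (auto simp: weight2_def smult_monom)

lemma g3_eq: "g3 N l \<mu> = weighted_product (weight3 N l \<mu>)"
  unfolding g3_def
  by (rule bilin_ext_eq_weighted_product) (auto simp: weight3_def smult_monom)

lemma g4_eq: "g4 l = weighted_product (weight4 l)"
  unfolding g4_def
  by (rule bilin_ext_eq_weighted_product) (auto simp: weight4_def smult_monom)

text \<open>For weights supported on the multiples of \<open>N\<close>, a pair of indices of which exactly one is a
  multiple of \<open>N\<close> has a sum outside the support, so both sides of the equation vanish.\<close>

lemma prelie_weightsI_multiples:
  fixes \<mu> :: "nat \<Rightarrow> 'a::field_char_0"
  assumes support: "\<And>j. \<not> N dvd j \<Longrightarrow> \<mu> j = 0"
    and eq: "\<And>j k. j \<ge> 1 \<Longrightarrow> k \<ge> 1 \<Longrightarrow> N dvd j \<Longrightarrow> N dvd k \<Longrightarrow>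
      (of_nat j - of_nat k) * (\<mu> j * \<mu> k) = \<mu> (j + k) * (of_nat j * \<mu> k - of_nat k * \<mu> j)"
  shows "prelie_weights \<mu>"
  unfolding prelie_weights_def
proof (intro allI)
  fix j k
  consider "j = 0" | "k = 0" | "j \<ge> 1" "k \<ge> 1" "N dvd j" "N dvd k"
    | "\<not> N dvd j" "\<not> N dvd k" | "N dvd j \<longleftrightarrow> \<not> N dvd k" by fastforce
  then show "(of_nat j - of_nat k) * (\<mu> j * \<mu> k)
      = \<mu> (j + k) * (of_nat j * \<mu> k - of_nat k * \<mu> j)"
  proof cases
    case 5
    then have "\<not> N dvd (j + k)"
      by (auto simp: dvd_add_right_iff dvd_add_left_iff)
    with 5 show ?thesis using support by auto
  qed (simp_all add: eq support)
qed

lemma prelie_weights_weight1: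
  assumes "N \<ge> 1" "b \<notin> {- of_nat n | n. n \<ge> 1}"
  shows "prelie_weights (weight1 N l a b)"
proof (rule prelie_weightsI_multiples)
  fix j k :: nat
  assume "j \<ge> 1" "k \<ge> 1" "N dvd j" "N dvd k"
  then obtain s t where jk: "j = N * s" "k = N * t" "s \<ge> 1" "t \<ge> 1"
    by (auto elim!: dvdE)
  have nz: "of_nat n + b \<noteq> 0" if "n \<ge> 1" for n
    using assms(2) that by (auto simp: add_eq_0_iff2 add_eq_0_iff)
  have w: "weight1 N l a b (N * n) = a / (of_nat n + b)" if "n \<ge> 1" for n
    using assms(1) that by (simp add: weight1_def)
  let ?s = "of_nat s :: 'a" and ?t = "of_nat t :: 'a"
  have nz': "?s + b \<noteq> 0" "?t + b \<noteq> 0" "?s + ?t + b \<noteq> 0"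
    using nz[of s] nz[of t] nz[of "s + t"] jk by simp_all
  have "(?s - ?t) * (a / (?s + b) * (a / (?t + b)))
      = a / (?s + ?t + b) * (?s * (a / (?t + b)) - ?t * (a / (?s + b)))"
    using nz' by (simp add: divide_simps) algebra
  then have "of_nat N * ((?s - ?t) * (a / (?s + b) * (a / (?t + b))))
      = of_nat N * (a / (?s + ?t + b) * (?s * (a / (?t + b)) - ?t * (a / (?s + b))))"
    by (rule arg_cong)
  moreover have "j + k = N * (s + t)" by (simp add: jk algebra_simps)
  ultimately show "(of_nat j - of_nat k) * (weight1 N l a b j * weight1 N l a b k)
      = weight1 N l a b (j + k) * (of_nat j * weight1 N l a b k - of_nat k * weight1 N l a b j)"
    using jk w[of s] w[of t] w[of "s + t"] by (simp add: algebra_simps)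
qed (auto simp: weight1_def)

lemma prelie_weights_weight2: "prelie_weights (weight2 N l \<mu>)"
  by (auto simp: prelie_weights_def weight2_def)

lemma prelie_weights_weight3: "prelie_weights (weight3 N l \<mu>)"
  by (rule prelie_weightsI_multiples[where N = N])
     (auto simp: weight3_def algebra_simps)

lemma prelie_weights_weight4: "prelie_weights (weight4 l)"
  by (auto simp: prelie_weights_def weight4_def)

section \<open>Solving the weight equation\<close>

text \<open>The weight equation at \<open>(N, k)\<close> propagates both the vanishing and the nonvanishing of weights
  from \<open>k\<close> to \<open>N + k\<close>. In the second case \<open>k = N\<close> must be excluded, because the equation on the
  diagonal is empty: this is why \<open>\<mu>\<^bsub>2N\<^esub>\<close> is a free parameter of the classification.\<close>

lemma prelie_weights_step_zero:
  assumes "prelie_weights \<mu>" "\<mu> N \<noteq> 0" "\<mu> k = 0" "k \<ge> 1"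
  shows "\<mu> (N + k) = 0"
proof -
  have "(of_nat N - of_nat k) * (\<mu> N * \<mu> k) = \<mu> (N + k) * (of_nat N * \<mu> k - of_nat k * \<mu> N)"
    using assms(1) unfolding prelie_weights_def by blast
  then show ?thesis using assms by simp
qed

lemma prelie_weights_step_nonzero:
  assumes "prelie_weights \<mu>" "\<mu> N \<noteq> 0" "\<mu> k \<noteq> 0" "k \<noteq> N"
  shows "\<mu> (N + k) \<noteq> 0"
proof
  assume "\<mu> (N + k) = 0"
  moreover have
    "(of_nat N - of_nat k) * (\<mu> N * \<mu> k) = \<mu> (N + k) * (of_nat N * \<mu> k - of_nat k * \<mu> N)"
    using assms(1) unfolding prelie_weights_def by blast
  ultimately show False using assms by simp
qed

text \<open>Descending from \<open>j\<close> in steps of \<open>N\<close> ends strictly between \<open>0\<close> and \<open>N\<close>, where \<open>\<mu>\<close> vanishes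
  by the choice of \<open>N\<close>.\<close>

lemma prelie_weights_support:
  assumes \<mu>: "prelie_weights \<mu>" and N: "N \<ge> 1" "\<mu> N \<noteq> 0" "\<And>j. 1 \<le> j \<Longrightarrow> j < N \<Longrightarrow> \<mu> j = 0"
    and j: "\<not> N dvd j"
  shows "\<mu> j = 0"
  using j
proof (induction j rule: less_induct)
  case (less j)
  then have "j \<noteq> 0" "j \<noteq> N" by (metis dvd_0_right, metis dvd_refl)
  then consider "1 \<le> j" "j < N" | "j > N" by linarith
  then show ?case
  proof cases
    case 1
    then show ?thesis by (rule N(3))
  next
    case 2
    have "j - N < j" "\<not> N dvd j - N"
      using less.prems \<open>j \<noteq> 0\<close> 2 N(1) by (auto simp: dvd_minus_self)
    then have "\<mu> (j - N) = 0" by (rule less.IH)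
    with prelie_weights_step_zero[OF \<mu> N(2), of "j - N"] 2 show ?thesis by simp
  qed
qed

text \<open>Dividing by \<open>\<mu>\<^sub>j \<mu>\<^sub>k \<mu>\<^bsub>j+k\<^esub>\<close> makes the equation linear in the reciprocals of the weights.\<close>

lemma prelie_weights_reciprocals:
  assumes \<mu>: "prelie_weights \<mu>" and nz: "\<mu> j \<noteq> 0" "\<mu> k \<noteq> 0" "\<mu> (j + k) \<noteq> 0"
  shows "(of_nat j - of_nat k) / \<mu> (j + k) = of_nat j / \<mu> j - of_nat k / \<mu> k"
proof -
  have "(of_nat j - of_nat k) * (\<mu> j * \<mu> k) = \<mu> (j + k) * (of_nat j * \<mu> k - of_nat k * \<mu> j)"
    using \<mu> unfolding prelie_weights_def by blast
  then show ?thesis using nz by (simp add: field_simps)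
qed

text \<open>The equation for \<open>j = 1\<close> determines \<open>w (k + 1)\<close> from \<open>w 1\<close> and \<open>w k\<close> once \<open>k \<ge> 2\<close>, and the
  affine sequence through \<open>w 1\<close> and \<open>w 2\<close> satisfies the same recursion.\<close>

lemma affine_if_recursion:
  fixes w :: "nat \<Rightarrow> 'a::field_char_0"
  assumes rec: "\<And>k. k \<ge> 2 \<Longrightarrow> (1 - of_nat k) * w (Suc k) = w 1 - of_nat k * w k"
    and "k \<ge> 1"
  shows "w k = (w 2 - w 1) * of_nat k + (2 * w 1 - w 2)"
  using \<open>k \<ge> 1\<close>
proof (induction k rule: nat_induct_at_least)
  case (Suc k)
  show ?case
  proof (cases "k = 1")
    case False
    with Suc.hyps have "k \<ge> 2" by simp
    then have "of_nat k \<noteq> (of_nat 1 :: 'a)" by (subst of_nat_eq_iff) simp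
    then have nz: "1 - of_nat k \<noteq> (0::'a)" by simp
    have "(1 - of_nat k) * w (Suc k)
        = (1 - of_nat k) * ((w 2 - w 1) * of_nat (Suc k) + (2 * w 1 - w 2))"
      unfolding rec[OF \<open>k \<ge> 2\<close>] Suc.IH by (simp add: algebra_simps)
    with nz show ?thesis by (simp only: mult_cancel_left) simp
  qed (simp add: numeral_2_eq_2 algebra_simps)
qed (simp add: algebra_simps)

lemma prelie_weights_cases:
  fixes \<mu> :: "nat \<Rightarrow> 'a::field_char_0"
  assumes \<mu>: "prelie_weights \<mu>"
  obtains (type1) N l a b where "N \<ge> 1" "a \<noteq> 0" "b \<notin> {- of_nat n | n. n \<ge> 1}" "\<mu> = weight1 N l a b"
    | (type2) N l m where "N \<ge> 1" "m \<noteq> 0" "\<mu> = weight2 N l m"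
    | (type3) N l m where "N \<ge> 1" "m \<noteq> 0" "\<mu> = weight3 N l m"
    | (type4) l where "\<mu> = weight4 l"
proof (cases "\<forall>j\<ge>1. \<mu> j = 0")
  case True
  then have "\<mu> = weight4 (\<mu> 0)" by (auto simp: fun_eq_iff weight4_def)
  then show ?thesis by (rule type4)
next
  case False
  define N where "N = (LEAST j. j \<ge> 1 \<and> \<mu> j \<noteq> 0)"
  have N: "N \<ge> 1" "\<mu> N \<noteq> 0"
    using LeastI_ex[of "\<lambda>j. j \<ge> 1 \<and> \<mu> j \<noteq> 0"] False unfolding N_def by auto
  have "\<mu> j = 0" if "1 \<le> j" "j < N" for j
    using not_less_Least[of j "\<lambda>j. j \<ge> 1 \<and> \<mu> j \<noteq> 0"] that unfolding N_def by auto
  then have support: "\<mu> j = 0" if "\<not> N dvd j" for j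
    using prelie_weights_support[OF \<mu> N] that by blast
  have index: "\<exists>k\<ge>1. j = N * k" if "N dvd j" "j \<noteq> 0" for j
    using that by (auto elim!: dvdE)
  show ?thesis
  proof (cases "\<mu> (N * 2) = 0")
    case True
    have zero: "\<mu> (N * k) = 0" if "k \<ge> 2" for k
      using that
    proof (induction k rule: nat_induct_at_least)
      case (Suc k)
      then show ?case using prelie_weights_step_zero[OF \<mu> N(2), of "N * k"] N(1) by simp
    qed (fact True)
    have "\<mu> = weight2 N (\<mu> 0) (\<mu> N)"
    proof
      fix j
      show "\<mu> j = weight2 N (\<mu> 0) (\<mu> N) j"
      proof (cases "N dvd j \<and> j \<noteq> 0")
        case True
        then obtain k where "k \<ge> 1" "j = N * k" using index by blast
        then show ?thesis using zero[of k] N(1) by (cases "k = 1") (auto simp: weight2_def)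
      qed (auto simp: weight2_def support)
    qed
    with N show ?thesis by (intro type2)
  next
    case False
    have nz: "\<mu> (N * k) \<noteq> 0" if "k \<ge> 1" for k
    proof (cases "k = 1")
      case False
      with that have "k \<ge> 2" by simp
      then show ?thesis
      proof (induction k rule: nat_induct_at_least)
        case (Suc k)
        then show ?case using prelie_weights_step_nonzero[OF \<mu> N(2), of "N * k"] N(1) by simp
      qed (fact \<open>\<mu> (N * 2) \<noteq> 0\<close>)
    qed (use N in simp)
    \<comment> \<open>On the multiples of \<open>N\<close> the reciprocals are affine, with slope \<open>\<alpha>\<close>; the slope decides
        between a constant weight and type 1 with \<open>a = 1 / \<alpha>\<close> and \<open>b = \<beta> / \<alpha>\<close>.\<close>
    define w where "w k = 1 / \<mu> (N * k)" for k
    define \<alpha> \<beta> where "\<alpha> = w 2 - w 1" and "\<beta> = 2 * w 1 - w 2"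
    have "(1 - of_nat k) * w (Suc k) = w 1 - of_nat k * w k" if "k \<ge> 2" for k
    proof -
      have "of_nat N * ((1 - of_nat k) * w (Suc k)) = of_nat N * (w 1 - of_nat k * w k)"
        using prelie_weights_reciprocals[OF \<mu>, of N "N * k"] nz[of k] nz[of "Suc k"] N that
        by (simp add: w_def algebra_simps diff_divide_distrib)
      with N(1) show ?thesis by (simp only: mult_cancel_left) simp
    qed
    from affine_if_recursion[of w, OF this] have affine: "w k = \<alpha> * of_nat k + \<beta>" if "k \<ge> 1" for k
      using that unfolding \<alpha>_def \<beta>_def by blast
    have \<mu>_eq: "\<mu> (N * k) = 1 / (\<alpha> * of_nat k + \<beta>)" if "k \<ge> 1" for k
      unfolding affine[OF that, symmetric] by (simp add: w_def)
    show ?thesis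
    proof (cases "\<alpha> = 0")
      case True
      have "\<mu> = weight3 N (\<mu> 0) (\<mu> N)"
      proof
        fix j
        show "\<mu> j = weight3 N (\<mu> 0) (\<mu> N) j"
        proof (cases "N dvd j \<and> j \<noteq> 0")
          case True
          then obtain k where "k \<ge> 1" "j = N * k" using index by blast
          then show ?thesis
            using \<mu>_eq[of k] \<mu>_eq[of 1] \<open>\<alpha> = 0\<close> N(1) by (auto simp: weight3_def)
        qed (auto simp: weight3_def support)
      qed
      with N show ?thesis by (intro type3)
    next
      case False
      \<comment> \<open>A reciprocal \<open>w n\<close> is nonzero, so \<open>\<alpha> n + \<beta> = \<alpha> (n + b)\<close> does not vanish.\<close>
      have b: "\<beta> / \<alpha> \<notin> {- of_nat n | n. n \<ge> 1}"
      proof clarify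
        fix n :: nat
        assume "\<beta> / \<alpha> = - of_nat n" "n \<ge> 1"
        then have "\<alpha> * of_nat n + \<beta> = 0" using False by (simp add: field_simps)
        with affine[of n] nz[of n] \<open>n \<ge> 1\<close> show False by (simp add: w_def)
      qed
      have "\<mu> = weight1 N (\<mu> 0) (1 / \<alpha>) (\<beta> / \<alpha>)"
      proof
        fix j
        show "\<mu> j = weight1 N (\<mu> 0) (1 / \<alpha>) (\<beta> / \<alpha>) j"
        proof (cases "N dvd j \<and> j \<noteq> 0")
          case True
          then obtain k where k: "k \<ge> 1" "j = N * k" using index by blast
          have "1 / \<alpha> / (of_nat k + \<beta> / \<alpha>) = 1 / (\<alpha> * of_nat k + \<beta>)"
            using False by (simp add: distrib_left)
          with k \<mu>_eq[of k] N(1) show ?thesis by (simp add: weight1_def)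
        qed (auto simp: weight1_def support)
      qed
      with N(1) b False show ?thesis by (intro type1) auto
    qed
  qed
qed

section \<open>The classification\<close>

theorem theorem3p1:
  shows "(\<forall>N (l::'a::field_char_0) a b.
            N \<ge> 1 \<and> a \<noteq> 0 \<and> b \<notin> {- of_nat n | n. n \<ge> 1} \<longrightarrow>
            zinbiel_prelie_poly (g1 N l a b))
    \<and> (\<forall>N (l::'a) \<mu>. N \<ge> 1 \<and> \<mu> \<noteq> 0 \<longrightarrow> zinbiel_prelie_poly (g2 N l \<mu>))
    \<and> (\<forall>N (l::'a) \<mu>. N \<ge> 1 \<and> \<mu> \<noteq> 0 \<longrightarrow> zinbiel_prelie_poly (g3 N l \<mu>))
    \<and> (\<forall>l::'a. zinbiel_prelie_poly (g4 l))
    \<and> (\<forall>p q. g4 (0::'a) p q = 0)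
    \<and> (\<forall>bullet :: 'a poly \<Rightarrow> 'a poly \<Rightarrow> 'a poly.
            com_prelie_algebra smult (*) bullet \<and> graded_product bullet \<longrightarrow>
              (\<exists>N l a b. N \<ge> 1 \<and> a \<noteq> 0 \<and> b \<notin> {- of_nat n | n. n \<ge> 1} \<and> bullet = g1 N l a b) \<or>
              (\<exists>N l \<mu>. N \<ge> 1 \<and> \<mu> \<noteq> 0 \<and> bullet = g2 N l \<mu>) \<or>
              (\<exists>N l \<mu>. N \<ge> 1 \<and> \<mu> \<noteq> 0 \<and> bullet = g3 N l \<mu>) \<or>
              (\<exists>l. bullet = g4 l))"
proof (intro conjI allI impI)
  fix bullet :: "'a poly \<Rightarrow> 'a poly \<Rightarrow> 'a poly"
  assume "com_prelie_algebra smult (*) bullet \<and> graded_product bullet"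
  then obtain \<mu> where \<mu>: "prelie_weights \<mu>" "bullet = weighted_product \<mu>"
    using graded_com_prelie_eq_weighted_product by blast
  from \<mu>(1) show "(\<exists>N l a b. N \<ge> 1 \<and> a \<noteq> 0 \<and> b \<notin> {- of_nat n | n. n \<ge> 1} \<and> bullet = g1 N l a b) \<or>
      (\<exists>N l \<mu>. N \<ge> 1 \<and> \<mu> \<noteq> 0 \<and> bullet = g2 N l \<mu>) \<or>
      (\<exists>N l \<mu>. N \<ge> 1 \<and> \<mu> \<noteq> 0 \<and> bullet = g3 N l \<mu>) \<or>
      (\<exists>l. bullet = g4 l)"
    unfolding g1_eq g2_eq g3_eq g4_eq \<mu>(2)
    by (cases rule: prelie_weights_cases) blast+
next
  fix p q :: "'a poly"
  show "g4 0 p q = 0"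
    by (auto simp: g4_def bilin_ext_def intro!: sum.neutral)
qed (simp_all add: g1_eq g2_eq g3_eq g4_eq weighted_product_zinbiel_prelie prelie_weights_weight1
       prelie_weights_weight2 prelie_weights_weight3 prelie_weights_weight4)

end
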